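(* Let $(X,d,\preceq)$ be an ordered metric space, $E$ an O-complete subspace of $X$ and $\ast\in\mathcal{U}_{\iota_n}$. Let $F:X^{n}\to X$ and $g:X\to X$ be two mappings. Suppose that the following conditions (i)-(vi) hold: (i) $F(X^n)\subseteq g(X)\cap E$; (ii) $F$ has the $\iota_n$-mixed $g$-monotone property; (iii) $F$ and $g$ are $(\ast,\mathrm{O})$-compatible; (iv) $g$ is O-continuous; (v) either $F$ is O-continuous or $(E,d,\preceq)$ has the $g$-MCB property; (vi) there exist $x^{(0)}_1,\dots,x^{(0)}_n\in X$ such that either [$g(x^{(0)}_i)\preceq F(x^{(0)}_{i_1},\dots,x^{(0)}_{i_n})$ for each $i\in A$ and $g(x^{(0)}_i)\succeq F(x^{(0)}_{i_1},\dots,x^{(0)}_{i_n})$ for each $i\in B$], or [$g(x^{(0)}_i)\succeq F(x^{(0)}_{i_1},\dots,x^{(0)}_{i_n})$ for each $i\in A$ and $g(x^{(0)}_i)\preceq F(x^{(0)}_{i_1},\dots,x^{(0)}_{i_n})$ for each $i\in B$]. Suppose moreover that at least one of the following two conditions holds: (vii) there exists $\varphi\in\Omega$ such that $$\frac1n\sum_{i=1}^n d\big(F(x_{i_1},\dots,x_{i_n}),F(y_{i_1},\dots,y_{i_n})\big)\le\varphi\Big(\frac1n\sum_{i=1}^n d(gx_i,gy_i)\Big)$$ for all $x_1,\dots,x_n,y_1,\dots,y_n\in X$ such that $(gx_1,\dots,gx_n)$ and $(gy_1,\dots,gy_n)$ are comparable with respect to $\sqsubseteq_{\iota_n}$; (vii$'$)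 there exists $\varphi\in\Omega$ such that $$\max_{i\in I_n} d\big(F(x_{i_1},\dots,x_{i_n}),F(y_{i_1},\dots,y_{i_n})\big)\le\varphi\Big(\max_{i\in I_n} d(gx_i,gy_i)\Big)$$ for all $x_1,\dots,x_n,y_1,\dots,y_n\in X$ such that $(gx_1,\dots,gx_n)$ and $(gy_1,\dots,gy_n)$ are comparable with respect to $\sqsubseteq_{\iota_n}$. Suppose in addition that for every pair $(x_1,\dots,x_n),(y_1,\dots,y_n)\in X^n$ there exists $(z_1,\dots,z_n)\in X^n$ such that $(gz_1,\dots,gz_n)$ is comparable to both $(gx_1,\dots,gx_n)$ and $(gy_1,\dots,gy_n)$ with respect to $\sqsubseteq_{\iota_n}$. Then $F$ and $g$ have a unique point of $\ast$-coincidence, which is also the unique common $\ast$-fixed point of $F$ and $g$.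
   Context: Fix an integer $n\ge 2$, put $I_n=\{1,\dots,n\}$, and let $\iota_n=\{A,B\}$ be a fixed partition of $I_n$ into two nonempty disjoint subsets $A,B$. For a binary operation $\ast:I_n\times I_n\to I_n$ write $i_k:=\ast(i,k)$. $\mathcal{U}_{\iota_n}$ is the set of all binary operations $\ast$ on $I_n$ with $\ast(A\times A)\subseteq A$, $\ast(A\times B)\subseteq B$, $\ast(B\times A)\subseteq B$, $\ast(B\times B)\subseteq A$. We write $gx$ for $g(x)$. An ordered metric space $(X,d,\preceq)$ is a nonempty set $X$ with a metric $d$ and a partial order $\preceq$; $x\succeq y$ means $y\preceq x$. On $X^n$, $(x_1,\dots,x_n)\sqsubseteq_{\iota_n}(y_1,\dots,y_n)$ means $x_i\preceq y_i$ for each $i\in A$ and $x_i\succeq y_i$ for each $i\in B$. Two elements of a partially ordered set are comparable if one is less than or equal to the other. A subspace is a nonempty subset with the restricted metric and order. Sequences are indexed by $m\in\mathbb{N}_0=\{0,1,2,\dots\}$. A sequence is increasing (decreasing) if $x^{(m)}\preceq x^{(l)}$ ($x^{(m)}\succeq x^{(l)}$) whenever $m<l$, and monotone if it is increasing or decreasing. $x^{(m)}\uparrow x$ (resp. $\downarrow x$, $\uparrow\downarrow x$) means $\{x^{(m)}\}$ is increasing (resp. decreasing, monotone) and converges to $x$ in $d$. An ordered metric space is O-complete if every monotone Cauchy sequence in it converges in it. $F:X^n\to X$ has the $\iota_n$-mixed $g$-monotone property if, with all other arguments fixed arbitrarily, $g(\underline{x}_i)\preceq g(\overline{x}_i)$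 implies $F(\dots,\underline{x}_i,\dots)\preceq F(\dots,\overline{x}_i,\dots)$ ($i$-th argument) when $i\in A$, and $F(\dots,\underline{x}_i,\dots)\succeq F(\dots,\overline{x}_i,\dots)$ when $i\in B$. $F$ and $g$ are $(\ast,\mathrm{O})$-compatible if for all sequences $\{x_1^{(m)}\},\dots,\{x_n^{(m)}\}$ in $X$ and all $z_1,\dots,z_n\in X$: if $g(x_i^{(m)})\uparrow\downarrow z_i$ and $F(x_{i_1}^{(m)},\dots,x_{i_n}^{(m)})\uparrow\downarrow z_i$ for each $i\in I_n$, then $\lim_{m\to\infty} d\big(gF(x_{i_1}^{(m)},\dots,x_{i_n}^{(m)}),F(gx_{i_1}^{(m)},\dots,gx_{i_n}^{(m)})\big)=0$ for each $i\in I_n$. $g$ is O-continuous if $x^{(m)}\uparrow\downarrow x$ implies $g(x^{(m)})\to g(x)$. $F$ is O-continuous if $x_i^{(m)}\uparrow\downarrow x_i$ for all $i\in I_n$ implies $F(x_1^{(m)},\dots,x_n^{(m)})\to F(x_1,\dots,x_n)$. $(E,d,\preceq)$ has the $g$-MCB property if for every sequence $\{x^{(m)}\}$ in $E$ and $x\in E$: $x^{(m)}\uparrow x$ implies $g(x^{(m)})\preceq g(x)$ for all $m$, and $x^{(m)}\downarrow x$ implies $g(x^{(m)})\succeq g(x)$ for all $m$. $\Omega$ is the set of functions $\varphi:[0,\infty)\to[0,\infty)$ with $\varphi(t)<t$ and $\limsup_{r\to t^+}\varphi(r)<t$ for every $t>0$. An $\ast$-coincidence point of $F$ and $g$ is $(x_1,\dots,x_n)\in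 X^n$ with $F(x_{i_1},\dots,x_{i_n})=g(x_i)$ for each $i\in I_n$; then $(gx_1,\dots,gx_n)$ is called a point of $\ast$-coincidence of $F$ and $g$. A common $\ast$-fixed point of $F$ and $g$ is $(x_1,\dots,x_n)\in X^n$ with $F(x_{i_1},\dots,x_{i_n})=g(x_i)=x_i$ for each $i\in I_n$. *)

theory Defs
  imports "HOL-Library.Extended_Real" "HOL-Library.Cardinality"
begin

text \<open>
  The ordered metric space \<open>X\<close> is a type \<open>'a :: {metric_space, order}\<close> (no relation between
  metric and order is implied), the index set \<open>I\<^sub>n\<close> is a finite type \<open>'n\<close> with
  \<open>n = CARD('n)\<close>, and \<open>X\<^sup>n\<close> is \<open>'n \<Rightarrow> 'a\<close>.  The partition \<open>\<iota>\<^sub>n = {A, B}\<close> is passed as the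
  ordered pair of arguments \<open>A\<close>, \<open>B\<close>, since the two blocks play different roles.
  The tuple written \<open>(x(i\<^sub>1), \<dots>, x(i\<^sub>n))\<close>, where \<open>i\<^sub>k\<close> is the value of the operation at
  \<open>(i, k)\<close>, is \<open>\<lambda>k. x (star i k)\<close>.
\<close>

definition index_partition :: "'n set \<Rightarrow> 'n set \<Rightarrow> bool" where
  "index_partition A B \<longleftrightarrow> A \<noteq> {} \<and> B \<noteq> {} \<and> A \<inter> B = {} \<and> A \<union> B = UNIV"

definition index_operations :: "'n set \<Rightarrow> 'n set \<Rightarrow> ('n \<Rightarrow> 'n \<Rightarrow> 'n) set" where
  "index_operations A B = {star.
     (\<forall>i\<in>A. \<forall>k\<in>A. star i k \<in> A) \<and> (\<forall>i\<in>A. \<forall>k\<in>B. star i k \<in> B) \<and>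
     (\<forall>i\<in>B. \<forall>k\<in>A. star i k \<in> B) \<and> (\<forall>i\<in>B. \<forall>k\<in>B. star i k \<in> A)}"

definition tuple_le :: "'n set \<Rightarrow> 'n set \<Rightarrow> ('n \<Rightarrow> 'a::order) \<Rightarrow> ('n \<Rightarrow> 'a) \<Rightarrow> bool" where
  "tuple_le A B x y \<longleftrightarrow> (\<forall>i\<in>A. x i \<le> y i) \<and> (\<forall>i\<in>B. x i \<ge> y i)"

definition comparable :: "'n set \<Rightarrow> 'n set \<Rightarrow> ('n \<Rightarrow> 'a::order) \<Rightarrow> ('n \<Rightarrow> 'a) \<Rightarrow> bool" where
  "comparable A B x y \<longleftrightarrow> tuple_le A B x y \<or> tuple_le A B y x"

definition mono_tendsto :: "(nat \<Rightarrow> 'a::{metric_space, order}) \<Rightarrow> 'a \<Rightarrow> bool" where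
  "mono_tendsto x l \<longleftrightarrow> monoseq x \<and> x \<longlonglongrightarrow> l"

definition O_complete :: "'a::{metric_space, order} set \<Rightarrow> bool" where
  "O_complete E \<longleftrightarrow>
     (\<forall>x. range x \<subseteq> E \<longrightarrow> monoseq x \<longrightarrow> Cauchy x \<longrightarrow> (\<exists>l\<in>E. x \<longlonglongrightarrow> l))"

definition mixed_g_monotone ::
    "'n set \<Rightarrow> 'n set \<Rightarrow> (('n \<Rightarrow> 'a::order) \<Rightarrow> 'a) \<Rightarrow> ('a \<Rightarrow> 'a) \<Rightarrow> bool" where
  "mixed_g_monotone A B F g \<longleftrightarrow>
     (\<forall>x a b.
        (\<forall>i\<in>A. g a \<le> g b \<longrightarrow> F (x(i := a)) \<le> F (x(i := b))) \<and>
        (\<forall>i\<in>B. g a \<le> g b \<longrightarrow> F (x(i := a)) \<ge> F (x(i := b))))"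

definition O_compatible ::
    "('n \<Rightarrow> 'n \<Rightarrow> 'n) \<Rightarrow> (('n \<Rightarrow> 'a::{metric_space, order}) \<Rightarrow> 'a) \<Rightarrow> ('a \<Rightarrow> 'a) \<Rightarrow> bool" where
  "O_compatible star F g \<longleftrightarrow>
     (\<forall>(x :: 'n \<Rightarrow> nat \<Rightarrow> 'a) (z :: 'n \<Rightarrow> 'a).
        (\<forall>i. mono_tendsto (\<lambda>m. g (x i m)) (z i) \<and>
             mono_tendsto (\<lambda>m. F (\<lambda>k. x (star i k) m)) (z i)) \<longrightarrow>
        (\<forall>i. (\<lambda>m. dist (g (F (\<lambda>k. x (star i k) m))) (F (\<lambda>k. g (x (star i k) m))))
               \<longlonglongrightarrow> 0))"

definition O_continuous :: "('a::{metric_space, order} \<Rightarrow> 'a) \<Rightarrow> bool" where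
  "O_continuous g \<longleftrightarrow> (\<forall>x l. mono_tendsto x l \<longrightarrow> (\<lambda>m. g (x m)) \<longlonglongrightarrow> g l)"

definition O_continuous_tuple :: "(('n \<Rightarrow> 'a::{metric_space, order}) \<Rightarrow> 'a) \<Rightarrow> bool" where
  "O_continuous_tuple F \<longleftrightarrow>
     (\<forall>(x :: 'n \<Rightarrow> nat \<Rightarrow> 'a) (l :: 'n \<Rightarrow> 'a).
        (\<forall>i. mono_tendsto (x i) (l i)) \<longrightarrow> (\<lambda>m. F (\<lambda>i. x i m)) \<longlonglongrightarrow> F l)"

definition MCB_property :: "'a::{metric_space, order} set \<Rightarrow> ('a \<Rightarrow> 'a) \<Rightarrow> bool" where
  "MCB_property E g \<longleftrightarrow>
     (\<forall>x. \<forall>l\<in>E. range x \<subseteq> E \<longrightarrow>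
        (incseq x \<and> x \<longlonglongrightarrow> l \<longrightarrow> (\<forall>m. g (x m) \<le> g l)) \<and>
        (decseq x \<and> x \<longlonglongrightarrow> l \<longrightarrow> (\<forall>m. g (x m) \<ge> g l)))"

text \<open>
  Functions \<open>[0,\<infinity>) \<Rightarrow> [0,\<infinity>)\<close> are total functions on \<open>real\<close> whose values at negative
  arguments are irrelevant.  The upper limit is taken in the extended reals, where it always
  exists.
\<close>

definition control_functions :: "(real \<Rightarrow> real) set" where
  "control_functions = {\<phi>.
     (\<forall>t\<ge>0. \<phi> t \<ge> 0) \<and>
     (\<forall>t>0. \<phi> t < t \<and> Limsup (at_right t) (\<lambda>r. ereal (\<phi> r)) < ereal t)}"

definition coincidence_point ::
    "('n \<Rightarrow> 'n \<Rightarrow> 'n) \<Rightarrow> (('n \<Rightarrow> 'a) \<Rightarrow> 'a) \<Rightarrow> ('a \<Rightarrow> 'a) \<Rightarrow> ('n \<Rightarrow> 'a) \<Rightarrow> bool" where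
  "coincidence_point star F g x \<longleftrightarrow> (\<forall>i. F (\<lambda>k. x (star i k)) = g (x i))"

definition point_of_coincidence ::
    "('n \<Rightarrow> 'n \<Rightarrow> 'n) \<Rightarrow> (('n \<Rightarrow> 'a) \<Rightarrow> 'a) \<Rightarrow> ('a \<Rightarrow> 'a) \<Rightarrow> ('n \<Rightarrow> 'a) \<Rightarrow> bool" where
  "point_of_coincidence star F g p \<longleftrightarrow>
     (\<exists>x. coincidence_point star F g x \<and> p = (\<lambda>i. g (x i)))"

definition common_fixed_point ::
    "('n \<Rightarrow> 'n \<Rightarrow> 'n) \<Rightarrow> (('n \<Rightarrow> 'a) \<Rightarrow> 'a) \<Rightarrow> ('a \<Rightarrow> 'a) \<Rightarrow> ('n \<Rightarrow> 'a) \<Rightarrow> bool" where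
  "common_fixed_point star F g x \<longleftrightarrow>
     (\<forall>i. F (\<lambda>k. x (star i k)) = g (x i) \<and> g (x i) = x i)"

end

(*
  Write G x = (g x_1, ..., g x_n) and T x for the tuple with entries F (x_{i_1}, ..., x_{i_n}).
  The mixed monotone property and the choice of star make T monotone relative to G for the
  mixed product order, so G x_(m+1) = T x_m defines an order-monotone orbit from the initial
  tuple.  For a product distance D on tuples (average or maximum of the distances of the entries)
  the hypothesis becomes D (T x) (T y) <= phi (D (G x) (G y)) on comparable tuples.  The
  Boyd-Wong argument makes the orbit Cauchy, and compatibility turns its limit into a
  coincidence point.  Two points of coincidence are both limits of an orbit started at a tuple
  comparable to both, hence equal; applying compatibility to a constant sequence, G maps the
  point of coincidence to a point of coincidence, that is, to itself.
*)
theory Submission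
  imports Defs
begin

section \<open>Control functions\<close>

text \<open>A right limit at a positive point does not see the value at \<open>0\<close>.
  Normalising that value makes the bound \<open>\<phi> t \<le> t\<close> hold at \<open>0\<close> as
  well.\<close>

lemma control_functions_upd_zero:
  assumes "\<phi> \<in> control_functions"
  shows "\<phi>(0 := 0) \<in> control_functions"
proof -
  have "Limsup (at_right t) (\<lambda>r. ereal ((\<phi>(0 := 0)) r)) = Limsup (at_right t) (\<lambda>r. ereal (\<phi> r))"
    if "t > 0" for t
  proof (rule Limsup_eq)
    have "\<forall>\<^sub>F r in at_right t. t < r"
      by (rule eventually_at_right_less)
    then show "\<forall>\<^sub>F r in at_right t. ereal ((\<phi>(0 := 0)) r) = ereal (\<phi> r)"
      by eventually_elim (use that in auto)
  qed
  with assms show ?thesis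
    by (simp add: control_functions_def)
qed

text \<open>The pointwise inequality at \<epsilon> and the limsup inequality to its right combine
  into one uniform bound below \<epsilon>. The Boyd-Wong arguments use the limsup condition only in
  this form.\<close>

lemma control_functions_gap:
  assumes "\<phi> \<in> control_functions" and "\<epsilon> > 0"
  obtains q \<delta> where "q < \<epsilon>" and "\<delta> > 0" and "\<And>r. \<lbrakk>\<epsilon> \<le> r; r < \<epsilon> + \<delta>\<rbrakk> \<Longrightarrow> \<phi> r \<le> q"
proof -
  have lim: "Limsup (at_right \<epsilon>) (\<lambda>r. ereal (\<phi> r)) < ereal \<epsilon>" and at: "\<phi> \<epsilon> < \<epsilon>"
    using assms by (auto simp: control_functions_def)
  \<comment> \<open>The upper limit may be infinite, so a real number is inserted strictly between
    it and \<epsilon>.\<close>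
  from ereal_dense2[OF lim] obtain p
    where p: "Limsup (at_right \<epsilon>) (\<lambda>r. ereal (\<phi> r)) < ereal p" "ereal p < ereal \<epsilon>"
    by blast
  from Limsup_lessD[OF p(1)] have "\<forall>\<^sub>F r in at_right \<epsilon>. \<phi> r < p"
    by simp
  then obtain b where b: "b > \<epsilon>" "\<And>r. \<lbrakk>r > \<epsilon>; r < b\<rbrakk> \<Longrightarrow> \<phi> r < p"
    by (auto simp: eventually_at_right_field)
  show thesis
  proof
    \<comment> \<open>The right limit says nothing about the point \<epsilon> itself, hence the
      maximum with \<open>\<phi> \<epsilon>\<close>.\<close>
    show "max p (\<phi> \<epsilon>) < \<epsilon>" and "b - \<epsilon> > 0"
      using p(2) at b(1) by auto
    show "\<phi> r \<le> max p (\<phi> \<epsilon>)" if "\<epsilon> \<le> r" "r < \<epsilon> + (b - \<epsilon>)" for r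
      using b(2)[of r] that by (cases "r = \<epsilon>") auto
  qed
qed

lemma control_functions_le:
  assumes "\<phi> \<in> control_functions" and "\<phi> 0 = 0" and "t \<ge> 0"
  shows "\<phi> t \<le> t"
  using assms by (cases "t = 0") (auto simp: control_functions_def intro: less_imp_le)

text \<open>The sequence decreases to some \<open>t \<ge> 0\<close>. If \<open>t\<close> were
  positive, a term close above \<open>t\<close> would be sent by \<phi> strictly below
  \<open>t\<close>, although no term lies below the limit.\<close>

lemma control_functions_iterates_tendsto_zero:
  assumes \<phi>: "\<phi> \<in> control_functions" "\<phi> 0 = 0"
    and nonneg: "\<And>m. a m \<ge> 0"
    and step: "\<And>m. a (Suc m) \<le> \<phi> (a m)"
  shows "a \<longlonglongrightarrow> 0"
proof -
  have dec: "decseq a"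
    using order_trans[OF step control_functions_le[OF \<phi> nonneg]] by (rule decseq_SucI)
  obtain t where t: "a \<longlonglongrightarrow> t" "\<And>m. t \<le> a m"
    using decseq_convergent[OF dec, of 0] nonneg by blast
  have "t \<ge> 0"
    using t(1) nonneg by (simp add: LIMSEQ_le_const)
  moreover have "\<not> t > 0"
  proof
    assume "t > 0"
    with \<phi>(1) obtain q \<delta> where gap:
      "q < t" "\<delta> > 0" "\<And>r. \<lbrakk>t \<le> r; r < t + \<delta>\<rbrakk> \<Longrightarrow> \<phi> r \<le> q"
      using control_functions_gap by blast
    have "\<forall>\<^sub>F m in sequentially. a m < t + \<delta>"
      using t(1) gap(2) by (auto intro: order_tendstoD)
    then obtain m where "a m < t + \<delta>"
      by (auto dest: eventually_happens)
    with gap(3)[OF t(2)] step[of m] have "a (Suc m) \<le> q"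
      by fastforce
    with t(2)[of "Suc m"] gap(1) show False
      by simp
  qed
  ultimately show ?thesis
    using t(1) by simp
qed

text \<open>Once consecutive distances are below a small \<eta>, induction on \<open>k\<close> traps
  \<open>y (m + k)\<close> within \<open>\<epsilon> / 2 + \<eta>\<close> of \<open>y m\<close>:
  distances below \<open>\<epsilon> / 2\<close> do not grow under \<phi>, and those in the remaining
  band are pushed down to \<open>q\<close>.\<close>

lemma control_functions_orbit_Cauchy:
  assumes \<phi>: "\<phi> \<in> control_functions" "\<phi> 0 = 0"
    and nonneg: "\<And>u v. D u v \<ge> 0"
    and self: "\<And>u. D u u = 0"
    and triangle: "\<And>u v w. D u w \<le> D u v + D v w"
    and step: "\<And>m k. D (y (Suc m)) (y (Suc k)) \<le> \<phi> (D (y m) (y k))"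
    and "\<epsilon> > 0"
  obtains N where "\<And>m k. m \<ge> N \<Longrightarrow> D (y m) (y (m + k)) < \<epsilon>"
proof -
  from \<open>\<epsilon> > 0\<close> have "\<epsilon> / 2 > 0"
    by simp
  then obtain q \<delta> where gap:
    "q < \<epsilon> / 2" "\<delta> > 0" "\<And>r. \<lbrakk>\<epsilon> / 2 \<le> r; r < \<epsilon> / 2 + \<delta>\<rbrakk> \<Longrightarrow> \<phi> r \<le> q"
    using control_functions_gap[OF \<phi>(1)] by blast
  \<comment> \<open>The three bounds keep the band inside the gap interval, give
    \<open>\<epsilon> / 2 + \<eta> \<le> \<epsilon>\<close>, and give
    \<open>q + \<eta> \<le> \<epsilon> / 2\<close>.\<close>
  define \<eta> where "\<eta> = min \<delta> (min (\<epsilon> / 2) (\<epsilon> / 2 - q))"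
  have \<eta>: "\<eta> > 0" "\<eta> \<le> \<delta>" "\<eta> \<le> \<epsilon> / 2" "\<eta> \<le> \<epsilon> / 2 - q"
    using gap(1,2) \<open>\<epsilon> > 0\<close> unfolding \<eta>_def by linarith+
  have "(\<lambda>m. D (y m) (y (Suc m))) \<longlonglongrightarrow> 0"
    by (rule control_functions_iterates_tendsto_zero[OF \<phi>, where a = "\<lambda>m. D (y m) (y (Suc m))",
          OF nonneg step])
  then have "\<forall>\<^sub>F m in sequentially. D (y m) (y (Suc m)) < \<eta>"
    using \<eta>(1) by (rule order_tendstoD)
  then obtain N where N: "\<And>m. m \<ge> N \<Longrightarrow> D (y m) (y (Suc m)) < \<eta>"
    by (auto simp: eventually_sequentially)
  have bound: "D (y m) (y (m + k)) < \<epsilon> / 2 + \<eta>" if "m \<ge> N" for m k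
  proof (induction k)
    case 0
    then show ?case
      using self \<open>\<epsilon> > 0\<close> \<eta>(1) by simp
  next
    case (Suc k)
    let ?r = "D (y m) (y (m + k))"
    \<comment> \<open>The detour through \<open>y (Suc m)\<close> costs less than \<eta>; its second
      leg is the image of the pair \<open>y m\<close>, \<open>y (m + k)\<close>.\<close>
    have *: "D (y m) (y (m + Suc k)) < \<eta> + \<phi> ?r"
      using triangle[of "y m" "y (m + Suc k)" "y (Suc m)"] N[OF that] step[of m "m + k"]
      by simp
    show ?case
    proof (cases "?r < \<epsilon> / 2")
      case True
      with * control_functions_le[OF \<phi> nonneg, of "y m" "y (m + k)"] show ?thesis
        by simp
    next
      case False
      with Suc.IH \<eta>(2) gap(3)[of ?r] have "\<phi> ?r \<le> q"
        by simp
      with * \<eta> show ?thesis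
        by simp
    qed
  qed
  show thesis
  proof
    show "D (y m) (y (m + k)) < \<epsilon>" if "m \<ge> N" for m k
      using bound[OF that, of k] \<eta>(3) by simp
  qed
qed

section \<open>Mixed monotonicity\<close>

lemma tuple_le_antisym:
  assumes "A \<union> B = UNIV" and "tuple_le A B x y" and "tuple_le A B y x"
  shows "x = y"
proof
  fix i
  have "i \<in> A \<or> i \<in> B"
    using assms(1) by blast
  then show "x i = y i"
    using assms(2,3) by (auto simp: tuple_le_def intro: antisym)
qed

lemma tuple_le_SucI:
  assumes "\<And>m. tuple_le A B (x m) (x (Suc m))" and "m \<le> k"
  shows "tuple_le A B (x m) (x k)"
proof -
  have "incseq (\<lambda>m. x m i)" if "i \<in> A" for i
    using assms(1) that by (intro incseq_SucI) (simp add: tuple_le_def)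
  moreover have "decseq (\<lambda>m. x m i)" if "i \<in> B" for i
    using assms(1) that by (intro decseq_SucI) (simp add: tuple_le_def)
  ultimately show ?thesis
    using \<open>m \<le> k\<close> by (auto simp: tuple_le_def dest: incseqD decseqD)
qed

text \<open>The mixed monotone property moves one argument at a time, so the entries of
  \<open>x\<close> are replaced by those of \<open>y\<close> one index after another.\<close>

lemma mixed_g_monotone_le:
  fixes x y :: "'n::finite \<Rightarrow> 'a::order"
  assumes "A \<union> B = UNIV" and "mixed_g_monotone A B F g"
    and "tuple_le A B (\<lambda>i. g (x i)) (\<lambda>i. g (y i))"
  shows "F x \<le> F y"
proof -
  have "F x \<le> F (\<lambda>k. if k \<in> S then y k else x k)" if "finite S" for S
    using that
  proof induction
    case empty
    then show ?case
      by simp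
  next
    case (insert k S)
    define w where "w = (\<lambda>k. if k \<in> S then y k else x k)"
    \<comment> \<open>Writing \<open>w\<close> as a trivial update at \<open>k\<close> makes both
      tuples updates of the same \<open>w\<close>, as the one-argument property requires.\<close>
    have "w(k := x k) = w"
      and eq: "w(k := y k) = (\<lambda>j. if j \<in> insert k S then y j else x j)"
      using \<open>k \<notin> S\<close> by (auto simp: w_def)
    moreover have "F (w(k := x k)) \<le> F (w(k := y k))"
    proof (cases "k \<in> A")
      case True
      with assms(2,3) show ?thesis
        by (simp add: mixed_g_monotone_def tuple_le_def)
    next
      case False
      with assms(1) have "k \<in> B"
        by blast
      with assms(2,3) show ?thesis
        by (simp add: mixed_g_monotone_def tuple_le_def)
    qed
    ultimately have "F w \<le> F (\<lambda>j. if j \<in> insert k S then y j else x j)"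
      by simp
    with insert.IH show ?case
      unfolding w_def by (rule order_trans)
  qed
  from this[of UNIV] show ?thesis
    by simp
qed

text \<open>For \<open>i\<close> in \<open>A\<close> the map \<open>star i\<close> preserves the two
  blocks, so the order of the permuted tuples is kept; for \<open>i\<close> in \<open>B\<close> it
  interchanges them, so the order is reversed, as \<open>tuple_le\<close> demands on
  \<open>B\<close>.\<close>

lemma mixed_g_monotone_tuple_le:
  fixes x y :: "'n::finite \<Rightarrow> 'a::order"
  assumes "A \<union> B = UNIV" and "star \<in> index_operations A B" and "mixed_g_monotone A B F g"
    and "tuple_le A B (\<lambda>i. g (x i)) (\<lambda>i. g (y i))"
  shows "tuple_le A B (\<lambda>i. F (\<lambda>k. x (star i k))) (\<lambda>i. F (\<lambda>k. y (star i k)))"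
  unfolding tuple_le_def
proof (intro conjI ballI)
  fix i assume "i \<in> A"
  then show "F (\<lambda>k. x (star i k)) \<le> F (\<lambda>k. y (star i k))"
    using assms(2,4)
    by (intro mixed_g_monotone_le[OF assms(1,3)]) (simp add: tuple_le_def index_operations_def)
next
  fix i assume "i \<in> B"
  then show "F (\<lambda>k. y (star i k)) \<le> F (\<lambda>k. x (star i k))"
    using assms(2,4)
    by (intro mixed_g_monotone_le[OF assms(1,3)]) (simp add: tuple_le_def index_operations_def)
qed

section \<open>Mixed contractions for a product distance\<close>

text \<open>Average and maximum distance are treated at once through an abstract \<open>D\<close>.
  The bounds by \<open>c * D\<close> and by the sum make \<open>D\<close> nonnegative, zero exactly
  on equal tuples, and equivalent to entrywise convergence.\<close>

locale mixed_contraction =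
  fixes A B :: "'n::finite set"
    and star :: "'n \<Rightarrow> 'n \<Rightarrow> 'n"
    and F :: "('n \<Rightarrow> 'a::{metric_space, order}) \<Rightarrow> 'a"
    and g :: "'a \<Rightarrow> 'a"
    and E :: "'a set"
    and D :: "('n \<Rightarrow> 'a) \<Rightarrow> ('n \<Rightarrow> 'a) \<Rightarrow> real"
    and c :: real
    and \<phi> :: "real \<Rightarrow> real"
  assumes cover: "A \<union> B = UNIV"
    and star: "star \<in> index_operations A B"
    and complete: "O_complete E"
    and range_F: "range F \<subseteq> range g \<inter> E"
    and monotone_F: "mixed_g_monotone A B F g"
    and compatible: "O_compatible star F g"
    and continuous_g: "O_continuous g"
    and continuous_F_or_MCB: "O_continuous_tuple F \<or> MCB_property E g"
    and D_triangle: "D u w \<le> D u v + D v w"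
    and c_pos: "c > 0"
    and dist_le_D: "dist (u i) (v i) \<le> c * D u v"
    and D_le_sum: "D u v \<le> (\<Sum>i\<in>UNIV. dist (u i) (v i))"
    and control: "\<phi> \<in> control_functions"
    and contraction: "comparable A B (\<lambda>i. g (x i)) (\<lambda>i. g (y i)) \<Longrightarrow>
      D (\<lambda>i. F (\<lambda>k. x (star i k))) (\<lambda>i. F (\<lambda>k. y (star i k)))
        \<le> \<phi> (D (\<lambda>i. g (x i)) (\<lambda>i. g (y i)))"
begin

abbreviation T :: "('n \<Rightarrow> 'a) \<Rightarrow> 'n \<Rightarrow> 'a" where
  "T x \<equiv> \<lambda>i. F (\<lambda>k. x (star i k))"

abbreviation G :: "('n \<Rightarrow> 'a) \<Rightarrow> 'n \<Rightarrow> 'a" where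
  "G x \<equiv> \<lambda>i. g (x i)"

section \<open>The product distance and entrywise convergence\<close>

lemma D_nonneg: "D u v \<ge> 0"
proof -
  have "0 \<le> c * D u v"
    \<comment> \<open>Here \<open>undefined\<close> serves as an arbitrary index.\<close>
    using dist_le_D[of u undefined v] zero_le_dist order_trans by blast
  then show ?thesis
    using c_pos by (simp add: zero_le_mult_iff)
qed

lemma D_self: "D u u = 0"
  using D_le_sum[of u u] D_nonneg[of u u] by simp

lemma D_eq_0: "u = v" if "D u v = 0"
  using dist_le_D[of u _ v] that by (intro ext) simp

lemma D_tendsto_zero_iff:
  "((\<lambda>m. D (u m) (v m)) \<longlonglongrightarrow> 0) \<longleftrightarrow> (\<forall>i. (\<lambda>m. dist (u m i) (v m i)) \<longlonglongrightarrow> 0)"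
proof (intro iffI allI)
  fix i
  assume "(\<lambda>m. D (u m) (v m)) \<longlonglongrightarrow> 0"
  then have "(\<lambda>m. c * D (u m) (v m)) \<longlonglongrightarrow> 0"
    by (rule tendsto_mult_right_zero)
  then show "(\<lambda>m. dist (u m i) (v m i)) \<longlonglongrightarrow> 0"
    by (rule tendsto_sandwich[OF _ _ tendsto_const, rotated 2])
      (simp_all add: dist_le_D)
next
  assume "\<forall>i. (\<lambda>m. dist (u m i) (v m i)) \<longlonglongrightarrow> 0"
  then have "(\<lambda>m. \<Sum>i\<in>UNIV. dist (u m i) (v m i)) \<longlonglongrightarrow> 0"
    by (intro tendsto_null_sum) simp
  then show "(\<lambda>m. D (u m) (v m)) \<longlonglongrightarrow> 0"
    by (rule tendsto_sandwich[OF _ _ tendsto_const, rotated 2])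
      (simp_all add: D_nonneg D_le_sum)
qed

section \<open>Monotonicity and contraction of \<open>T\<close> relative to \<open>G\<close>\<close>

lemma tuple_le_T: "tuple_le A B (T x) (T y)" if "tuple_le A B (G x) (G y)"
  using mixed_g_monotone_tuple_le[OF cover star monotone_F that] .

lemma comparable_T: "comparable A B (T x) (T y)" if "comparable A B (G x) (G y)"
  using that tuple_le_T by (auto simp: comparable_def)

abbreviation \<psi> :: "real \<Rightarrow> real" where
  "\<psi> \<equiv> \<phi>(0 := 0)"

lemmas control_\<psi> = control_functions_upd_zero[OF control]

text \<open>
  The value of a control function at \<open>0\<close> is unconstrained; it can be reset to \<open>0\<close> because
  by antisymmetry \<open>G x = G y\<close> forces \<open>T x = T y\<close>.
\<close>

lemma contraction_upd_zero:
  assumes "comparable A B (G x) (G y)"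
  shows "D (T x) (T y) \<le> \<psi> (D (G x) (G y))"
proof (cases "D (G x) (G y) = 0")
  case True
  then have "G x = G y"
    by (rule D_eq_0)
  then have "tuple_le A B (G x) (G y)" and "tuple_le A B (G y) (G x)"
    by (simp_all add: tuple_le_def fun_eq_iff)
  then have "T x = T y"
    by (intro tuple_le_antisym[OF cover] tuple_le_T)
  then show ?thesis
    using True D_self by simp
next
  case False
  then show ?thesis
    using contraction[OF assms] by simp
qed

lemma nonexpansive:
  assumes "comparable A B (G x) (G y)"
  shows "D (T x) (T y) \<le> D (G x) (G y)"
  using contraction_upd_zero[OF assms] control_functions_le[OF control_\<psi> _ D_nonneg]
  by (rule order_trans) simp

section \<open>Orbits, their order and their limits\<close>

lemma orbit_exists:
  obtains x where "x 0 = x0" and "\<And>m. G (x (Suc m)) = T (x m)"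
proof -
  \<comment> \<open>Every value of \<open>F\<close> lies in the range of \<open>g\<close>, so
    \<open>inv g\<close> chooses a preimage in each entry.\<close>
  define next_tuple where "next_tuple u = (\<lambda>i. inv g (T u i))" for u
  have "G (next_tuple u) = T u" for u
    using range_F by (auto simp: next_tuple_def fun_eq_iff intro!: f_inv_into_f)
  then show thesis
    by (intro that[of "\<lambda>m. (next_tuple ^^ m) x0"]) simp_all
qed

text \<open>Since \<open>T p = G p\<close>, comparability with \<open>G p\<close> passes along the
  orbit, and the distances to \<open>G p\<close> are iterates controlled by \<psi>.\<close>

lemma orbit_tendsto_coincidence:
  assumes orbit: "\<And>m. G (x (Suc m)) = T (x m)"
    and p: "coincidence_point star F g p"
    and start: "comparable A B (G (x 0)) (G p)"
  shows "(\<lambda>m. g (x m i)) \<longlonglongrightarrow> g (p i)"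
proof -
  have Tp: "T p = G p"
    using p by (simp add: coincidence_point_def)
  have comp: "comparable A B (G (x m)) (G p)" for m
  proof (induction m)
    case (Suc m)
    then show ?case
      unfolding orbit using comparable_T[of "x m" p] Tp by simp
  qed (fact start)
  have "(\<lambda>m. D (G (x m)) (G p)) \<longlonglongrightarrow> 0"
  proof (rule control_functions_iterates_tendsto_zero[OF control_\<psi>])
    show "D (G (x (Suc m))) (G p) \<le> \<psi> (D (G (x m)) (G p))" for m
      unfolding orbit using contraction_upd_zero[OF comp[of m]] Tp by simp
  qed (simp_all add: D_nonneg)
  then have "(\<lambda>m. dist (g (x m i)) (g (p i))) \<longlonglongrightarrow> 0"
    by (simp add: D_tendsto_zero_iff)
  then show ?thesis
    by (simp flip: tendsto_dist_iff)
qed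

text \<open>The orbit is a chain, so any two of its members are comparable; the Cauchy estimate
  needs the contraction for all such pairs.\<close>

lemma orbit_tuple_le:
  assumes orbit: "\<And>m. G (x (Suc m)) = T (x m)"
  shows "tuple_le A B (G (x 0)) (T (x 0)) \<Longrightarrow> m \<le> k \<Longrightarrow> tuple_le A B (G (x m)) (G (x k))"
    and "tuple_le A B (T (x 0)) (G (x 0)) \<Longrightarrow> m \<le> k \<Longrightarrow> tuple_le A B (G (x k)) (G (x m))"
proof -
  assume start: "tuple_le A B (G (x 0)) (T (x 0))" and "m \<le> k"
  have "tuple_le A B (G (x m)) (G (x (Suc m)))" for m
  proof (induction m)
    case 0
    then show ?case
      unfolding orbit by (fact start)
  next
    case (Suc m)
    show ?case
      using tuple_le_T[OF Suc] by (simp only: orbit)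
  qed
  from tuple_le_SucI[where x = "\<lambda>m. G (x m)", OF this \<open>m \<le> k\<close>] show "tuple_le A B (G (x m)) (G (x k))" .
next
  \<comment> \<open>Swapping the blocks reverses the order, which turns the descending case into an
    ascending one.\<close>
  have flip: "tuple_le B A u v \<longleftrightarrow> tuple_le A B v u" for u v :: "'n \<Rightarrow> 'a"
    by (auto simp: tuple_le_def)
  assume start: "tuple_le A B (T (x 0)) (G (x 0))" and "m \<le> k"
  have "tuple_le A B (G (x (Suc m))) (G (x m))" for m
  proof (induction m)
    case 0
    then show ?case
      unfolding orbit by (fact start)
  next
    case (Suc m)
    show ?case
      using tuple_le_T[OF Suc] by (simp only: orbit)
  qed
  then have "tuple_le B A (G (x m)) (G (x (Suc m)))" for m
    by (simp only: flip)
  from tuple_le_SucI[where x = "\<lambda>m. G (x m)", OF this \<open>m \<le> k\<close>] show "tuple_le A B (G (x k)) (G (x m))"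
    by (simp only: flip)
qed

section \<open>Existence of a coincidence point\<close>

lemma coincidence_point_exists:
  assumes "tuple_le A B (G x0) (T x0) \<or> tuple_le A B (T x0) (G x0)"
  obtains z where "coincidence_point star F g z"
proof -
  obtain x where x_0: "x 0 = x0" and orbit: "\<And>m. G (x (Suc m)) = T (x m)"
    using orbit_exists by blast
  have start: "tuple_le A B (G (x 0)) (T (x 0)) \<or> tuple_le A B (T (x 0)) (G (x 0))"
    using assms by (simp add: x_0)
  have entry: "F (\<lambda>k. x m (star i k)) = g (x (Suc m) i)" for m i
    using fun_cong[OF orbit[of m], of i] by simp

  \<comment> \<open>The shift by one makes every \<open>s i m\<close> a value of \<open>F\<close>,
    hence an element of \<open>E\<close>; \<open>g (x 0 i)\<close> may lie outside
    \<open>E\<close>.\<close>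
  define s where "s i m = g (x (Suc m) i)" for i m
  have s_E: "range (s i) \<subseteq> E" for i
    using range_F by (auto simp: s_def simp flip: entry)
  have up: "incseq (s i)" if "tuple_le A B (G (x 0)) (T (x 0))" "i \<in> A" for i
    using orbit_tuple_le(1)[where x = x, OF orbit that(1)] that(2)
    by (auto simp: s_def incseq_def tuple_le_def)
  have up': "decseq (s i)" if "tuple_le A B (G (x 0)) (T (x 0))" "i \<in> B" for i
    using orbit_tuple_le(1)[where x = x, OF orbit that(1)] that(2)
    by (auto simp: s_def decseq_def tuple_le_def)
  have down: "decseq (s i)" if "tuple_le A B (T (x 0)) (G (x 0))" "i \<in> A" for i
    using orbit_tuple_le(2)[where x = x, OF orbit that(1)] that(2)
    by (auto simp: s_def decseq_def tuple_le_def)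
  have down': "incseq (s i)" if "tuple_le A B (T (x 0)) (G (x 0))" "i \<in> B" for i
    using orbit_tuple_le(2)[where x = x, OF orbit that(1)] that(2)
    by (auto simp: s_def incseq_def tuple_le_def)
  have mono: "monoseq (s i)" for i
    using start cover up up' down down' by (metis UNIV_I UnE monoseq_iff)

  have comp: "comparable A B (G (x m)) (G (x k))" for m k
    using start orbit_tuple_le[where x = x, OF orbit] nat_le_linear[of m k] unfolding comparable_def by blast
  have D_step: "D (G (x (Suc m))) (G (x (Suc k))) \<le> \<psi> (D (G (x m)) (G (x k)))" for m k
    unfolding orbit by (rule contraction_upd_zero[OF comp])
  have Cauchy: "Cauchy (s i)" for i
  proof (rule metric_CauchyI)
    fix e :: real
    assume "e > 0"
    \<comment> \<open>The factor \<open>c\<close> converts closeness in \<open>D\<close> into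
      closeness of single entries.\<close>
    then have "e / c > 0"
      using c_pos by simp
    then obtain N where N: "\<And>m k. m \<ge> N \<Longrightarrow> D (G (x m)) (G (x (m + k))) < e / c"
      using control_functions_orbit_Cauchy
        [where D = D and y = "\<lambda>m. G (x m)", OF control_\<psi> _ D_nonneg D_self D_triangle D_step]
      by auto
    have close: "dist (s i m) (s i k) < e" if "N \<le> m" "m \<le> k" for m k
    proof -
      have "dist (s i m) (s i k) \<le> c * D (G (x (Suc m))) (G (x (Suc m + (k - m))))"
        using dist_le_D[of "G (x (Suc m))" i "G (x (Suc k))"] that by (simp add: s_def)
      also have "\<dots> < e"
        using N[of "Suc m" "k - m"] that c_pos by (simp add: field_simps)
      finally show ?thesis .
    qed
    then show "\<exists>N. \<forall>m\<ge>N. \<forall>k\<ge>N. dist (s i m) (s i k) < e"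
      by (metis dist_commute nat_le_linear)
  qed
  have "\<forall>i. \<exists>l\<in>E. s i \<longlonglongrightarrow> l"
    using complete s_E mono Cauchy by (simp add: O_complete_def)
  then obtain z where z_E: "\<And>i. z i \<in> E" and lim: "\<And>i. s i \<longlonglongrightarrow> z i"
    by metis
  have s_tendsto: "mono_tendsto (s i) (z i)" for i
    using mono lim by (simp add: mono_tendsto_def)
  have s_Suc: "mono_tendsto (\<lambda>m. s i (Suc m)) (z i)" for i
    using mono[of i] LIMSEQ_Suc[OF lim[of i]] by (auto simp: mono_tendsto_def monoseq_def)

  have s_entry: "F (\<lambda>k. x (Suc m) (star i k)) = s i (Suc m)" for m i
    by (simp add: entry s_def)
  \<comment> \<open>Compatibility is applied to the orbit shifted by one: its
    \<open>g\<close>-values are \<open>s i m\<close> and its \<open>F\<close>-values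
    \<open>s i (Suc m)\<close>, both monotone with limit \<open>z i\<close>.\<close>
  have gap: "(\<lambda>m. dist (g (s i (Suc m))) (F (\<lambda>k. s (star i k) m))) \<longlonglongrightarrow> 0" for i
    using compatible[unfolded O_compatible_def, rule_format,
        where x = "\<lambda>i m. x (Suc m) i" and z = z and i = i] s_tendsto s_Suc
    by (simp add: s_entry flip: s_def)
  have gs: "(\<lambda>m. g (s i m)) \<longlonglongrightarrow> g (z i)" for i
    using continuous_g s_tendsto by (simp add: O_continuous_def)
  have "(\<lambda>m. F (\<lambda>k. s (star i k) m)) \<longlonglongrightarrow> F (\<lambda>k. z (star i k))" for i
    using continuous_F_or_MCB
  proof
    assume "O_continuous_tuple F"
    then show ?thesis
      using s_tendsto unfolding O_continuous_tuple_def
      by (elim allE[of _ "\<lambda>k. s (star i k)"] allE[of _ "\<lambda>k. z (star i k)"]) simp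
  next
    \<comment> \<open>The MCB property makes \<open>G z\<close> comparable to the image under
      \<open>G\<close> of each tuple of the sequence. Nonexpansiveness then transfers the
      convergence of these images to the values of \<open>T\<close>.\<close>
    assume MCB: "MCB_property E g"
    have inc: "g (s i m) \<le> g (z i)" if "incseq (s i)" for i m
      using MCB s_E z_E lim that by (simp add: MCB_property_def)
    have dec: "g (z i) \<le> g (s i m)" if "decseq (s i)" for i m
      using MCB s_E z_E lim that by (simp add: MCB_property_def)
    have "comparable A B (G (\<lambda>i. s i m)) (G z)" for m
      using start inc dec up up' down down' unfolding comparable_def tuple_le_def by blast
    then have le: "D (T (\<lambda>i. s i m)) (T z) \<le> D (G (\<lambda>i. s i m)) (G z)" for m
      by (rule nonexpansive)
    have "(\<lambda>m. D (G (\<lambda>i. s i m)) (G z)) \<longlonglongrightarrow> 0"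
      unfolding D_tendsto_zero_iff using gs by (simp flip: tendsto_dist_iff)
    then have "(\<lambda>m. D (T (\<lambda>i. s i m)) (T z)) \<longlonglongrightarrow> 0"
      by (rule tendsto_sandwich[OF _ _ tendsto_const, rotated 2])
        (simp_all add: D_nonneg le)
    then show ?thesis
      unfolding D_tendsto_zero_iff by (simp flip: tendsto_dist_iff)
  qed
  \<comment> \<open>By \<open>gap\<close> the same sequence tends to \<open>0\<close>, so the two
    limits agree and \<open>z\<close> is a coincidence point.\<close>
  then have "(\<lambda>m. dist (g (s i (Suc m))) (F (\<lambda>k. s (star i k) m)))
      \<longlonglongrightarrow> dist (g (z i)) (F (\<lambda>k. z (star i k)))" for i
    by (intro tendsto_dist LIMSEQ_Suc[OF gs])
  then have "dist (g (z i)) (F (\<lambda>k. z (star i k))) = 0" for i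
    using gap LIMSEQ_unique by blast
  then have "coincidence_point star F g z"
    by (simp add: coincidence_point_def)
  then show thesis
    by (rule that)
qed

section \<open>Uniqueness and the common fixed point\<close>

lemma point_of_coincidence_unique:
  assumes "\<exists>u. comparable A B (G u) (G x) \<and> comparable A B (G u) (G y)"
    and "coincidence_point star F g x" and "coincidence_point star F g y"
  shows "G x = G y"
proof
  fix i
  obtain u where u: "comparable A B (G u) (G x)" "comparable A B (G u) (G y)"
    using assms(1) by blast
  \<comment> \<open>A single orbit from \<open>u\<close> converges entrywise to both points of
    coincidence.\<close>
  obtain v where "v 0 = u" and orbit: "\<And>m. G (v (Suc m)) = T (v m)"
    using orbit_exists by blast
  with u show "g (x i) = g (y i)"
    using orbit_tendsto_coincidence[where x = v, OF orbit assms(2)] orbit_tendsto_coincidence[where x = v, OF orbit assms(3)]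
      LIMSEQ_unique by metis
qed

text \<open>At a coincidence point the constant sequences have equal \<open>g\<close>- and
  \<open>F\<close>-values, so compatibility applies; a constant sequence of distances tending to
  \<open>0\<close> is \<open>0\<close>.\<close>

lemma coincidence_point_G:
  assumes "coincidence_point star F g x"
  shows "coincidence_point star F g (G x)"
proof -
  have const: "mono_tendsto (\<lambda>m. l) l" for l :: 'a
    by (simp add: mono_tendsto_def monoseq_def)
  have entry: "F (\<lambda>k. x (star i k)) = g (x i)" for i
    using assms by (simp add: coincidence_point_def)
  have "(\<lambda>m. dist (g (g (x i))) (F (\<lambda>k. g (x (star i k))))) \<longlonglongrightarrow> 0" for i
    using compatible[unfolded O_compatible_def, rule_format,
        where x = "\<lambda>i m. x i" and z = "G x" and i = i] const
    by (simp add: entry)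
  then show ?thesis
    by (simp add: coincidence_point_def LIMSEQ_const_iff)
qed

theorem unique_common_fixed_point:
  assumes start: "tuple_le A B (G x0) (T x0) \<or> tuple_le A B (T x0) (G x0)"
    and directed: "\<And>x y. \<exists>u. comparable A B (G u) (G x) \<and> comparable A B (G u) (G y)"
  shows "\<exists>p. point_of_coincidence star F g p \<and>
             (\<forall>q. point_of_coincidence star F g q \<longrightarrow> q = p) \<and>
             common_fixed_point star F g p \<and>
             (\<forall>q. common_fixed_point star F g q \<longrightarrow> q = p)"
proof -
  obtain z where z: "coincidence_point star F g z"
    using coincidence_point_exists[OF start] .
  have unique: "G x = G z" if "coincidence_point star F g x" for x
    using point_of_coincidence_unique[OF directed that z] .
  have Gz: "coincidence_point star F g (G z)"
    by (rule coincidence_point_G[OF z])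
  show ?thesis
  proof (intro exI[of _ "G z"] conjI allI impI)
    show "point_of_coincidence star F g (G z)"
      using z by (auto simp: point_of_coincidence_def)
    show "q = G z" if "point_of_coincidence star F g q" for q
      using that unique by (auto simp: point_of_coincidence_def)
    \<comment> \<open>As \<open>G z\<close> is again a coincidence point, uniqueness yields
      \<open>G (G z) = G z\<close>.\<close>
    show "common_fixed_point star F g (G z)"
      using Gz fun_cong[OF unique[OF Gz]]
      by (simp add: common_fixed_point_def coincidence_point_def)
    show "q = G z" if "common_fixed_point star F g q" for q
    proof -
      from that have "coincidence_point star F g q" and "G q = q"
        by (simp_all add: common_fixed_point_def coincidence_point_def)
      then show ?thesis
        using unique by simp
    qed
  qed
qed

end

section \<open>Average and maximum distance\<close>

theorem theorem2:
  fixes A B :: "'n::finite set"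
    and star :: "'n \<Rightarrow> 'n \<Rightarrow> 'n"
    and F :: "('n \<Rightarrow> 'a::{metric_space, order}) \<Rightarrow> 'a"
    and g :: "'a \<Rightarrow> 'a"
    and E :: "'a set"
  assumes "CARD('n) \<ge> (2::nat)"
    and "index_partition A B"
    and "star \<in> index_operations A B"
    and "E \<noteq> {}" and "O_complete E"
    and i: "range F \<subseteq> range g \<inter> E"
    and ii: "mixed_g_monotone A B F g"
    and iii: "O_compatible star F g"
    and iv: "O_continuous g"
    and v: "O_continuous_tuple F \<or> MCB_property E g"
    and vi: "\<exists>x0 :: 'n \<Rightarrow> 'a.
          ((\<forall>i\<in>A. g (x0 i) \<le> F (\<lambda>k. x0 (star i k))) \<and>
           (\<forall>i\<in>B. g (x0 i) \<ge> F (\<lambda>k. x0 (star i k)))) \<or>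
          ((\<forall>i\<in>A. g (x0 i) \<ge> F (\<lambda>k. x0 (star i k))) \<and>
           (\<forall>i\<in>B. g (x0 i) \<le> F (\<lambda>k. x0 (star i k))))"
    and vii: "(\<exists>\<phi> \<in> control_functions. \<forall>x y :: 'n \<Rightarrow> 'a.
            comparable A B (\<lambda>i. g (x i)) (\<lambda>i. g (y i)) \<longrightarrow>
            (1 / real CARD('n)) * (\<Sum>i\<in>UNIV. dist (F (\<lambda>k. x (star i k))) (F (\<lambda>k. y (star i k))))
              \<le> \<phi> ((1 / real CARD('n)) * (\<Sum>i\<in>UNIV. dist (g (x i)) (g (y i))))) \<or>
         (\<exists>\<phi> \<in> control_functions. \<forall>x y :: 'n \<Rightarrow> 'a.
            comparable A B (\<lambda>i. g (x i)) (\<lambda>i. g (y i)) \<longrightarrow>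
            (MAX i\<in>UNIV. dist (F (\<lambda>k. x (star i k))) (F (\<lambda>k. y (star i k))))
              \<le> \<phi> (MAX i\<in>UNIV. dist (g (x i)) (g (y i))))"
    and "\<forall>x y :: 'n \<Rightarrow> 'a. \<exists>z :: 'n \<Rightarrow> 'a.
          comparable A B (\<lambda>i. g (z i)) (\<lambda>i. g (x i)) \<and>
          comparable A B (\<lambda>i. g (z i)) (\<lambda>i. g (y i))"
  shows "\<exists>p. point_of_coincidence star F g p \<and>
             (\<forall>q. point_of_coincidence star F g q \<longrightarrow> q = p) \<and>
             common_fixed_point star F g p \<and>
             (\<forall>q. common_fixed_point star F g q \<longrightarrow> q = p)"
proof -
  have cover: "A \<union> B = UNIV"
    using \<open>index_partition A B\<close> by (simp add: index_partition_def)
  have n_pos: "real CARD('n) > 0"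
    by simp
  obtain x0 where start:
    "tuple_le A B (\<lambda>i. g (x0 i)) (\<lambda>i. F (\<lambda>k. x0 (star i k))) \<or>
     tuple_le A B (\<lambda>i. F (\<lambda>k. x0 (star i k))) (\<lambda>i. g (x0 i))"
    using vi by (auto simp: tuple_le_def)
  have directed: "\<exists>u. comparable A B (\<lambda>i. g (u i)) (\<lambda>i. g (x i)) \<and>
      comparable A B (\<lambda>i. g (u i)) (\<lambda>i. g (y i))" for x y :: "'n \<Rightarrow> 'a"
    using assms(13) by blast
  have entry_le_sum: "dist (u j) (v j) \<le> (\<Sum>i\<in>UNIV. dist (u i) (v i))" for u v :: "'n \<Rightarrow> 'a" and j
    by (rule member_le_sum) auto
  from vii show ?thesis
  proof (elim disjE bexE)
    fix \<phi>
    assume \<phi>: "\<phi> \<in> control_functions"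
      and contr: "\<forall>x y :: 'n \<Rightarrow> 'a. comparable A B (\<lambda>i. g (x i)) (\<lambda>i. g (y i)) \<longrightarrow>
        (1 / real CARD('n)) * (\<Sum>i\<in>UNIV. dist (F (\<lambda>k. x (star i k))) (F (\<lambda>k. y (star i k))))
          \<le> \<phi> ((1 / real CARD('n)) * (\<Sum>i\<in>UNIV. dist (g (x i)) (g (y i))))"
    let ?D = "\<lambda>u v :: 'n \<Rightarrow> 'a. (1 / real CARD('n)) * (\<Sum>i\<in>UNIV. dist (u i) (v i))"
    \<comment> \<open>One entry is at most the whole sum, which is \<open>CARD('n)\<close> times the
      average; this is the constant \<open>c\<close>.\<close>
    interpret mixed_contraction A B star F g E ?D "real CARD('n)" \<phi>
    proof (standard; (fact | simp only: contr)?)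
      show "?D u w \<le> ?D u v + ?D v w" for u v w
      proof -
        have "(\<Sum>i\<in>UNIV. dist (u i) (w i)) \<le> (\<Sum>i\<in>UNIV. dist (u i) (v i) + dist (v i) (w i))"
          by (intro sum_mono dist_triangle)
        then show ?thesis
          by (simp add: sum.distrib divide_right_mono flip: add_divide_distrib)
      qed
      show "dist (u j) (v j) \<le> real CARD('n) * ?D u v" for u v j
        using entry_le_sum by simp
      show "?D u v \<le> (\<Sum>i\<in>UNIV. dist (u i) (v i))" for u v
        by (intro mult_left_le_one_le) (auto simp: sum_nonneg Suc_leI)
    qed
    show ?thesis
      by (rule unique_common_fixed_point[OF start directed])
  next
    fix \<phi>
    assume \<phi>: "\<phi> \<in> control_functions"
      and contr: "\<forall>x y :: 'n \<Rightarrow> 'a. comparable A B (\<lambda>i. g (x i)) (\<lambda>i. g (y i)) \<longrightarrow>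
        (MAX i\<in>UNIV. dist (F (\<lambda>k. x (star i k))) (F (\<lambda>k. y (star i k))))
          \<le> \<phi> (MAX i\<in>UNIV. dist (g (x i)) (g (y i)))"
    let ?D = "\<lambda>u v :: 'n \<Rightarrow> 'a. (MAX i\<in>UNIV. dist (u i) (v i))"
    have entry_le: "dist (u j) (v j) \<le> ?D u v" for u v j
      by (rule Max_ge) auto
    have D_le: "?D u v \<le> r" if "\<And>i. dist (u i) (v i) \<le> r" for u v r
      using that by (subst Max_le_iff) auto
    \<comment> \<open>The maximum dominates each entry, so \<open>c = 1\<close> suffices.\<close>
    interpret mixed_contraction A B star F g E ?D 1 \<phi>
    proof (standard; (fact | simp only: contr)?)
      show "?D u w \<le> ?D u v + ?D v w" for u v w
        by (rule D_le, rule order_trans[OF dist_triangle add_mono[OF entry_le entry_le]])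
      show "dist (u j) (v j) \<le> 1 * ?D u v" for u v j
        using entry_le by simp
      show "?D u v \<le> (\<Sum>i\<in>UNIV. dist (u i) (v i))" for u v
        by (intro D_le entry_le_sum)
    qed
    show ?thesis
      by (rule unique_common_fixed_point[OF start directed])
  qed
qed

end
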